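(* Let $n \geq 1$ be an integer and let $\mathbb{F}_q$ be a finite field. If $q$ is odd, then for all sign patterns $\epsilon \in \{\pm1\}^n$, $$\# TPM_n^{\mathbb{F}_q} = \# LPM_n^{\mathbb{F}_q} = 2^n\, \# LPM_n^{\mathbb{F}_q}(\epsilon) = 2^n\, \# TPM_n^{\mathbb{F}_q}(\epsilon) = (q-1)^n q^{\binom{n}{2}},$$ where $q^{\binom{1}{2}} := 1$. If $q$ is even, then for all $\epsilon \in \{\pm1\}^n$, $$\# TPM_n^{\mathbb{F}_q} = \# LPM_n^{\mathbb{F}_q} = \# LPM_n^{\mathbb{F}_q}(\epsilon) = \# TPM_n^{\mathbb{F}_q}(\epsilon) = (q-1)^n q^{\binom{n}{2}}.$$
   Context: An element of $\mathbb{F}_q^\times$ is positive if it is a nonzero square, and negative otherwise. The quadratic character $\chi$ takes the value $1$ on positive elements, $-1$ on negative elements, and $\chi(0)=0$. $LPM_n^{\mathbb{F}_q}$ (resp. $TPM_n^{\mathbb{F}_q}$) is the set of symmetric matrices in $\mathbb{F}_q^{n\times n}$ all of whose leading (upper-left), resp. trailing (lower-right), principal minors are nonzero. For $\epsilon\in\{\pm1\}^n$, $LPM_n^{\mathbb{F}_q}(\epsilon)$ (resp. $TPM_n^{\mathbb{F}_q}(\epsilon)$) is the set of symmetric matrices in $\mathbb{F}_q^{n\times n}$ whose $k\times k$ leading (resp. trailing) principal minor has quadratic character $\epsilon_k$ for each $k=1,\dots,n$. Convention: when $q$ is even (so all nonzero elements are positive), $LPM_n^{\mathbb{F}_q}(\epsilon)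 := LPM_n^{\mathbb{F}_q}$ and $TPM_n^{\mathbb{F}_q}(\epsilon) := TPM_n^{\mathbb{F}_q}$ for every $\epsilon$. *)

theory Defs
  imports
    Jordan_Normal_Form.Determinant
    Jordan_Normal_Form.DL_Submatrix
    "HOL-Computational_Algebra.Nth_Powers"
    "HOL-Library.Cardinality"
begin

definition positive_elem :: "'a::field \<Rightarrow> bool" where
  "positive_elem x \<longleftrightarrow> x \<noteq> 0 \<and> is_square x"

definition quadratic_character :: "'a::field \<Rightarrow> int" where
  "quadratic_character x = (if x = 0 then 0 else if positive_elem x then 1 else -1)"

definition symmetric_mats :: "nat \<Rightarrow> 'a mat set" where
  "symmetric_mats n = {A \<in> carrier_mat n n. transpose_mat A = A}"

text \<open>Matrix indices start at 0, while minors are indexed by their size \<open>k\<close>, so that the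
  relevant range is \<open>1 \<le> k \<le> n\<close>. Sign patterns are functions \<open>nat \<Rightarrow> int\<close> of which only the
  values on \<open>{1..n}\<close> matter.\<close>

definition leading_minor :: "nat \<Rightarrow> 'a::field mat \<Rightarrow> 'a" where
  "leading_minor k A = det (submatrix A {0..<k} {0..<k})"

definition trailing_minor :: "nat \<Rightarrow> 'a::field mat \<Rightarrow> 'a" where
  "trailing_minor k A =
    det (submatrix A {dim_row A - k..<dim_row A} {dim_col A - k..<dim_col A})"

definition LPM :: "nat \<Rightarrow> 'a::{field,finite} mat set" where
  "LPM n = {A \<in> symmetric_mats n. \<forall>k\<in>{1..n}. leading_minor k A \<noteq> 0}"

definition TPM :: "nat \<Rightarrow> 'a::{field,finite} mat set" where
  "TPM n = {A \<in> symmetric_mats n. \<forall>k\<in>{1..n}. trailing_minor k A \<noteq> 0}"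

text \<open>Over a field of even order every nonzero element is a square. The convention there is that
  the sign pattern is ignored, also if it contains \<open>-1\<close>.\<close>

definition LPM_sign :: "nat \<Rightarrow> (nat \<Rightarrow> int) \<Rightarrow> 'a::{field,finite} mat set" where
  "LPM_sign n \<epsilon> =
    (if even CARD('a) then LPM n
     else {A \<in> symmetric_mats n. \<forall>k\<in>{1..n}. quadratic_character (leading_minor k A) = \<epsilon> k})"

definition TPM_sign :: "nat \<Rightarrow> (nat \<Rightarrow> int) \<Rightarrow> 'a::{field,finite} mat set" where
  "TPM_sign n \<epsilon> =
    (if even CARD('a) then TPM n
     else {A \<in> symmetric_mats n. \<forall>k\<in>{1..n}. quadratic_character (trailing_minor k A) = \<epsilon> k})"

end

theory Submission
  imports Defs "HOL-Library.FuncSet" "HOL-Number_Theory.Residues"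
begin

text \<open>Border a symmetric \<open>n \<times> n\<close> matrix \<open>A\<close> with nonzero determinant by a column \<open>v\<close>, its
  transpose and a corner entry \<open>d\<close>. The determinant of the bordered matrix is an affine function of
  \<open>d\<close> with slope \<open>det A\<close>, so for given \<open>A\<close> and \<open>v\<close> it takes every value exactly once. Hence each of
  the matrices counted in size \<open>n\<close> has \<open>q ^ n\<close> times the number of admissible values of the last
  minor many extensions. Over a field of odd order, half of the nonzero values have a given sign.
  Reversing the order of rows and columns exchanges leading and trailing minors.\<close>

text \<open>Covers both counts at once: \<open>S k = - {0}\<close> gives \<open>LPM\<close>, and
  taking for \<open>S k\<close> the elements of character \<open>\<epsilon> k\<close> gives
  \<open>LPM_sign\<close> over a field of odd order.\<close>

definition minors_in :: "nat \<Rightarrow> (nat \<Rightarrow> 'a set) \<Rightarrow> 'a::field mat set" where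
  "minors_in n S = {A \<in> symmetric_mats n. \<forall>k\<in>{1..n}. leading_minor k A \<in> S k}"

definition border :: "nat \<Rightarrow> 'a mat \<Rightarrow> (nat \<Rightarrow> 'a) \<Rightarrow> 'a \<Rightarrow> 'a mat" where
  "border n A v d = mat (Suc n) (Suc n) (\<lambda>(i, j).
     if i < n then (if j < n then A $$ (i, j) else v i) else (if j < n then v j else d))"

definition reverse_mat :: "'a mat \<Rightarrow> 'a mat" where
  "reverse_mat A = mat (dim_row A) (dim_col A)
     (\<lambda>(i, j). A $$ (dim_row A - Suc i, dim_col A - Suc j))"

section \<open>Minors as determinants of explicit matrices\<close>

lemma pick_atLeastLessThan:
  assumes "i < b - a"
  shows "pick {a..<b} i = a + i"
proof -
  \<comment> \<open>Exactly \<open>i\<close> elements of the interval lie below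
    \<open>a + i\<close>, and \<open>pick\<close> numbers elements by this count.\<close>
  have "{x \<in> {a..<b}. x < a + i} = {a..<a + i}"
    using assms by auto
  then show ?thesis
    using pick_card_in_set[of "a + i" "{a..<b}"] assms by simp
qed

text \<open>The offsets \<open>a = 0\<close> and \<open>a = n - k\<close> yield the leading and the
  trailing block.\<close>

lemma submatrix_interval:
  assumes "A \<in> carrier_mat n n" "a + k \<le> n"
  shows "submatrix A {a..<a + k} {a..<a + k} = mat k k (\<lambda>(i, j). A $$ (a + i, a + j))"
proof -
  have "{i. i < n \<and> i \<in> {a..<a + k}} = {a..<a + k}"
    using assms(2) by auto
  then have "card {i. i < n \<and> i \<in> {a..<a + k}} = k"
    by simp
  then show ?thesis
    using assms(1) by (intro eq_matI) (auto simp: submatrix_def pick_atLeastLessThan)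
qed

lemma leading_minor_eq:
  assumes "A \<in> carrier_mat n n" "k \<le> n"
  shows "leading_minor k A = det (mat k k (\<lambda>(i, j). A $$ (i, j)))"
  using submatrix_interval[OF assms(1), of 0 k] assms(2) by (simp add: leading_minor_def)

lemma trailing_minor_eq:
  assumes "A \<in> carrier_mat n n" "k \<le> n"
  shows "trailing_minor k A = det (mat k k (\<lambda>(i, j). A $$ (n - k + i, n - k + j)))"
  using submatrix_interval[OF assms(1), of "n - k" k] assms by (simp add: trailing_minor_def)

lemma leading_minor_full:
  assumes "A \<in> carrier_mat n n"
  shows "leading_minor n A = det A"
proof -
  have "mat n n (\<lambda>(i, j). A $$ (i, j)) = A"
    using assms by (intro eq_matI) auto
  then show ?thesis
    using leading_minor_eq[OF assms order_refl] by simp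
qed

section \<open>Reversing the order of rows and columns\<close>

lemma reverse_mat_carrier: "A \<in> carrier_mat n m \<Longrightarrow> reverse_mat A \<in> carrier_mat n m"
  by (simp add: reverse_mat_def)

lemma reverse_mat_reverse_mat: "reverse_mat (reverse_mat A) = A"
  by (intro eq_matI) (auto simp: reverse_mat_def)

lemma transpose_reverse_mat: "(reverse_mat A)\<^sup>T = reverse_mat (A\<^sup>T)"
  by (intro eq_matI) (auto simp: reverse_mat_def)

text \<open>Rows and columns undergo the same permutation, so its sign enters twice and
  cancels.\<close>

lemma det_reverse_mat:
  fixes A :: "'a::comm_ring_1 mat"
  assumes A: "A \<in> carrier_mat n n"
  shows "det (reverse_mat A) = det A"
proof -
  \<comment> \<open>An involution on \<open>{0..<n}\<close>, continued by the identity because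
    \<open>permutes\<close> demands this outside the set.\<close>
  define p where "p i = (if i < n then n - Suc i else i)" for i
  have p: "p permutes {0..<n}"
    by (rule bij_imp_permutes, rule bij_betwI[where g = p]) (auto simp: p_def)
  define B where "B = mat n n (\<lambda>(i, j). A $$ (p i, j))"
  have B: "B \<in> carrier_mat n n"
    by (simp add: B_def)
  \<comment> \<open>\<open>B\<close> has the rows permuted already. Permuting its columns amounts to
    permuting the rows of \<open>B\<^sup>T\<close>, so \<open>det_permute_rows\<close> serves both
    times.\<close>
  have "reverse_mat A = (mat n n (\<lambda>(i, j). B\<^sup>T $$ (p i, j)))\<^sup>T"
    using A by (intro eq_matI) (auto simp: reverse_mat_def B_def p_def)
  then have "det (reverse_mat A) = det (mat n n (\<lambda>(i, j). B\<^sup>T $$ (p i, j)))"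
    using det_transpose[of "mat n n (\<lambda>(i, j). B\<^sup>T $$ (p i, j))" n] by simp
  also have "\<dots> = signof p * det (B\<^sup>T)"
    by (rule det_permute_rows) (use B p in auto)
  also have "\<dots> = signof p * (signof p * det A)"
    using det_transpose[OF B] det_permute_rows[OF A p] by (simp add: B_def)
  also have "\<dots> = det A"
    by (simp add: sign_def)
  finally show ?thesis .
qed

text \<open>The leading block of size \<open>k\<close> of the reversed matrix is the reversed
  trailing block of \<open>A\<close>.\<close>

lemma leading_minor_reverse_mat:
  assumes A: "A \<in> carrier_mat n n" and k: "k \<le> n"
  shows "leading_minor k (reverse_mat A) = trailing_minor k A"
proof -
  let ?B = "mat k k (\<lambda>(i, j). A $$ (n - k + i, n - k + j))"
  have "mat k k (\<lambda>(i, j). reverse_mat A $$ (i, j)) = reverse_mat ?B"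
    using A k by (intro eq_matI) (auto simp: reverse_mat_def)
  then show ?thesis
    using leading_minor_eq[OF reverse_mat_carrier[OF A] k] trailing_minor_eq[OF A k]
      det_reverse_mat[of ?B k] by simp
qed

lemma trailing_minor_reverse_mat:
  assumes "A \<in> carrier_mat n n" "k \<le> n"
  shows "trailing_minor k (reverse_mat A) = leading_minor k A"
  using leading_minor_reverse_mat[OF reverse_mat_carrier[OF assms(1)] assms(2)]
  by (simp add: reverse_mat_reverse_mat)

text \<open>Reversal is an involution that preserves symmetry. As \<open>S\<close> is arbitrary,
  this reduces both trailing counts to leading ones.\<close>

lemma card_trailing_minors_in:
  "card {A \<in> symmetric_mats n. \<forall>k\<in>{1..n}. trailing_minor k A \<in> S k} = card (minors_in n S)"
proof -
  have "bij_betw reverse_mat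
      {A \<in> symmetric_mats n. \<forall>k\<in>{1..n}. trailing_minor k A \<in> S k} (minors_in n S)"
  proof (rule bij_betwI[where g = reverse_mat])
    show "reverse_mat \<in> {A \<in> symmetric_mats n. \<forall>k\<in>{1..n}. trailing_minor k A \<in> S k}
        \<rightarrow> minors_in n S"
      by (auto simp: minors_in_def symmetric_mats_def reverse_mat_carrier transpose_reverse_mat
          leading_minor_reverse_mat)
    show "reverse_mat \<in> minors_in n S
        \<rightarrow> {A \<in> symmetric_mats n. \<forall>k\<in>{1..n}. trailing_minor k A \<in> S k}"
      by (auto simp: minors_in_def symmetric_mats_def reverse_mat_carrier transpose_reverse_mat
          trailing_minor_reverse_mat)
  qed (simp_all add: reverse_mat_reverse_mat)
  then show ?thesis
    by (rule bij_betw_same_card)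
qed

section \<open>Bordering a symmetric matrix\<close>

lemma border_carrier: "border n A v d \<in> carrier_mat (Suc n) (Suc n)"
  by (simp add: border_def)

text \<open>Expand along the last row: its cofactors delete the row that contains \<open>d\<close>,
  so \<open>d\<close> enters only as the coefficient of the corner cofactor
  \<open>det A\<close>.\<close>

lemma det_border:
  fixes A :: "'a::comm_ring_1 mat"
  assumes A: "A \<in> carrier_mat n n"
  shows "det (border n A v d) = d * det A + det (border n A v 0)"
proof -
  have expand: "det (border n A v e) = (\<Sum>j<n. v j * cofactor (border n A v 0) n j) + e * det A"
    for e
  proof -
    have "mat_delete (border n A v e) n j = mat_delete (border n A v 0) n j" for j
      by (intro eq_matI) (auto simp: mat_delete_def border_def)
    then have cof: "cofactor (border n A v e) n j = cofactor (border n A v 0) n j" for j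
      by (simp add: cofactor_def)
    have "mat_delete (border n A v 0) n n = A"
      using A by (intro eq_matI) (auto simp: mat_delete_def border_def)
    \<comment> \<open>The sign of the corner cofactor is that of an even power of -1, with exponent
      \<open>n + n\<close>.\<close>
    then have corner: "cofactor (border n A v 0) n n = det A"
      by (simp add: cofactor_def power_add[symmetric] mult_2[symmetric])
    have "det (border n A v e)
        = (\<Sum>j<Suc n. border n A v e $$ (n, j) * cofactor (border n A v e) n j)"
      by (rule laplace_expansion_row[OF border_carrier]) simp
    then show ?thesis
      by (simp add: cof corner) (simp add: border_def)
  qed
  show ?thesis
    by (subst (1 2) expand) (simp add: algebra_simps)
qed

lemma leading_minor_border:
  assumes "A \<in> carrier_mat n n" "k \<le> n"
  shows "leading_minor k (border n A v d) = leading_minor k A"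
proof -
  have "mat k k (\<lambda>(i, j). border n A v d $$ (i, j)) = mat k k (\<lambda>(i, j). A $$ (i, j))"
    using assms by (intro eq_matI) (auto simp: border_def)
  then show ?thesis
    using leading_minor_eq[OF border_carrier, of k n A v d] leading_minor_eq[OF assms] assms(2)
    by simp
qed

lemma symmetric_mats_sym:
  assumes "A \<in> symmetric_mats n" "i < n" "j < n"
  shows "A $$ (i, j) = A $$ (j, i)"
  using assms unfolding symmetric_mats_def
  by (metis (mono_tags, lifting) carrier_matD index_transpose_mat(1) mem_Collect_eq)

lemma border_symmetric:
  assumes "A \<in> symmetric_mats n"
  shows "border n A v d \<in> symmetric_mats (Suc n)"
  using symmetric_mats_sym[OF assms]
  by (auto simp: symmetric_mats_def border_def intro!: eq_matI)

text \<open>The sum is dependent because the admissible \<open>d\<close> vary with \<open>A\<close>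
  and \<open>v\<close>. As \<open>border\<close> sees \<open>v\<close> only below \<open>n\<close>,
  extensional functions are taken so that each column occurs once.\<close>

lemma minors_in_Suc:
  "minors_in (Suc n) S = (\<lambda>((A, v), d). border n A v d) `
     (SIGMA (A, v):minors_in n S \<times> ({..<n} \<rightarrow>\<^sub>E UNIV). {d. det (border n A v d) \<in> S (Suc n)})"
    (is "_ = ?f ` ?D")
proof (intro equalityI subsetI)
  fix B assume "B \<in> minors_in (Suc n) S"
  then have B: "B \<in> symmetric_mats (Suc n)" "B \<in> carrier_mat (Suc n) (Suc n)"
    and minors: "\<And>k. k \<in> {1..Suc n} \<Longrightarrow> leading_minor k B \<in> S k"
    by (auto simp: minors_in_def symmetric_mats_def)
  define A where "A = mat n n (\<lambda>(i, j). B $$ (i, j))"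
  define v where "v = restrict (\<lambda>i. B $$ (i, n)) {..<n}"
  define d where "d = B $$ (n, n)"
  have A: "A \<in> symmetric_mats n" "A \<in> carrier_mat n n"
    using symmetric_mats_sym[OF B(1)] by (auto simp: symmetric_mats_def A_def intro!: eq_matI)
  have eq: "border n A v d = B"
    using B(2) symmetric_mats_sym[OF B(1)]
    by (intro eq_matI) (auto simp: border_def A_def v_def d_def less_Suc_eq)
  have "leading_minor k A \<in> S k" if "k \<in> {1..n}" for k
    using that minors[of k] leading_minor_border[OF A(2), of k v d] by (simp add: eq)
  then have "A \<in> minors_in n S"
    using A by (simp add: minors_in_def)
  moreover have "det B \<in> S (Suc n)"
    using minors[of "Suc n"] leading_minor_full[OF B(2)] by simp
  ultimately have "((A, v), d) \<in> ?D"
    by (simp add: eq) (simp add: v_def)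
  then show "B \<in> ?f ` ?D"
    using eq by force
next
  fix B assume "B \<in> ?f ` ?D"
  then obtain A v d where B: "B = border n A v d" and A: "A \<in> minors_in n S"
    and d: "det (border n A v d) \<in> S (Suc n)"
    by auto
  have sym: "A \<in> symmetric_mats n" "A \<in> carrier_mat n n"
    using A by (auto simp: minors_in_def symmetric_mats_def)
  have "leading_minor k B \<in> S k" if "k \<in> {1..Suc n}" for k
  proof (cases "k = Suc n")
    case True
    then show ?thesis
      using d by (simp add: B leading_minor_full[OF border_carrier])
  next
    case False
    then show ?thesis
      using that A leading_minor_border[OF sym(2)] by (simp add: B minors_in_def)
  qed
  then show "B \<in> minors_in (Suc n) S"
    using border_symmetric[OF sym(1)] by (simp add: minors_in_def B)
qed

lemma inj_on_border:
  assumes "M \<subseteq> carrier_mat n n"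
  shows "inj_on (\<lambda>((A, v), d). border n A v d)
    (SIGMA (A, v):M \<times> ({..<n} \<rightarrow>\<^sub>E UNIV). D A v)"
proof (rule inj_onI)
  fix x y
  let ?f = "\<lambda>((A, v), d). border n A v d"
    and ?D = "SIGMA (A, v):M \<times> ({..<n} \<rightarrow>\<^sub>E UNIV). D A v"
  assume xy: "x \<in> ?D" "y \<in> ?D" "?f x = ?f y"
  obtain A v d A' v' d' where xy_eq: "x = ((A, v), d)" "y = ((A', v'), d')"
    by (metis surj_pair)
  have eq: "border n A v d = border n A' v' d'"
    and A: "A \<in> M" "A' \<in> M" and v: "v \<in> {..<n} \<rightarrow>\<^sub>E UNIV" "v' \<in> {..<n} \<rightarrow>\<^sub>E UNIV"
    using xy by (auto simp: xy_eq)
  have entry: "border n A v d $$ (i, j) = border n A' v' d' $$ (i, j)" for i j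
    using eq by simp
  have "A = A'"
  proof (rule eq_matI)
    fix i j assume "i < dim_row A'" "j < dim_col A'"
    then have "i < n" "j < n"
      using A assms by auto
    then show "A $$ (i, j) = A' $$ (i, j)"
      using entry[of i j] by (simp add: border_def)
  qed (use A assms in auto)
  moreover have "v = v'"
  \<comment> \<open>Agreement below \<open>n\<close> suffices, since both functions are
    \<open>undefined\<close> elsewhere.\<close>
  proof (rule PiE_ext[OF v])
    fix i assume "i \<in> {..<n}"
    then show "v i = v' i"
      using entry[of i n] by (simp add: border_def)
  qed
  moreover have "d = d'"
    using entry[of n n] by (simp add: border_def)
  ultimately show "x = y"
    by (simp add: xy_eq)
qed

section \<open>Counting by induction on the size\<close>

lemma card_affine_vimage:
  fixes a c :: "'a::field"
  assumes "a \<noteq> 0"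
  shows "card {d. d * a + c \<in> T} = card T"
proof -
  have "bij_betw (\<lambda>d. d * a + c) {d. d * a + c \<in> T} T"
    by (rule bij_betwI[where g = "\<lambda>y. (y - c) / a"]) (use assms in auto)
  then show ?thesis
    by (rule bij_betw_same_card)
qed

text \<open>Supplies the nonzero slope that is needed to border \<open>A\<close> once more.\<close>

lemma minors_in_det_nonzero:
  assumes "A \<in> minors_in n S" "\<And>k. k \<in> {1..n} \<Longrightarrow> 0 \<notin> S k"
  shows "det A \<noteq> 0"
proof (cases "n = 0")
  \<comment> \<open>No minor is constrained here, but the empty matrix has determinant 1.\<close>
  case True
  with assms(1) show ?thesis
    by (simp add: minors_in_def symmetric_mats_def)
next
  case False
  with assms(1) have "leading_minor n A \<in> S n" "A \<in> carrier_mat n n"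
    by (auto simp: minors_in_def symmetric_mats_def)
  with False assms(2)[of n] show ?thesis
    by (auto simp: leading_minor_full)
qed

lemma finite_minors_in: "finite (minors_in n S :: 'a::{field,finite} mat set)"
proof (induction n)
  case 0
  have "minors_in 0 S \<subseteq> {1\<^sub>m 0}"
    by (auto simp: minors_in_def symmetric_mats_def)
  then show ?case
    by (rule finite_subset) simp
next
  case (Suc n)
  show ?case
    unfolding minors_in_Suc
    by (intro finite_imageI finite_SigmaI finite_cartesian_product Suc finite_PiE) auto
qed

text \<open>Passing from size \<open>n\<close> to \<open>Suc n\<close> leaves
  \<open>CARD('a) ^ n\<close> choices for \<open>v\<close> and then \<open>card (S (Suc n))\<close>
  choices for \<open>d\<close>. The exponents 0, 1, ..., \<open>n - 1\<close> add up to
  \<open>n choose 2\<close>.\<close>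

lemma card_minors_in:
  fixes S :: "nat \<Rightarrow> 'a::{field,finite} set"
  assumes "\<And>k. k \<in> {1..n} \<Longrightarrow> 0 \<notin> S k"
  shows "card (minors_in n S) = (\<Prod>k=1..n. card (S k)) * CARD('a) ^ (n choose 2)"
  using assms
proof (induction n)
  case 0
  have "minors_in 0 S = {1\<^sub>m 0}"
    by (auto simp: minors_in_def symmetric_mats_def)
  then show ?case
    by (simp add: numeral_2_eq_2)
next
  case (Suc n)
  let ?M = "minors_in n S" and ?V = "{..<n} \<rightarrow>\<^sub>E (UNIV :: 'a set)"
  have IH: "card ?M = (\<Prod>k=1..n. card (S k)) * CARD('a) ^ (n choose 2)"
    using Suc by simp
  have M: "?M \<subseteq> carrier_mat n n"
    by (auto simp: minors_in_def symmetric_mats_def)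
  have fibre: "card {d. det (border n A v d) \<in> S (Suc n)} = card (S (Suc n))" if "A \<in> ?M" for A v
  proof -
    have "A \<in> carrier_mat n n" "det A \<noteq> 0"
      using that M minors_in_det_nonzero[OF that] Suc.prems by auto
    then show ?thesis
      using card_affine_vimage[of "det A" "det (border n A v 0)" "S (Suc n)"]
      by (subst det_border) auto
  qed
  have "card (minors_in (Suc n) S)
      = card (SIGMA (A, v):?M \<times> ?V. {d. det (border n A v d) \<in> S (Suc n)})"
    unfolding minors_in_Suc by (rule card_image[OF inj_on_border[OF M]])
  also have "\<dots> = (\<Sum>(A, v)\<in>?M \<times> ?V. card {d. det (border n A v d) \<in> S (Suc n)})"
    by (subst card_SigmaI) (auto simp: finite_minors_in finite_PiE intro!: sum.cong)
  also have "\<dots> = (\<Sum>x\<in>?M \<times> ?V. card (S (Suc n)))"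
    by (rule sum.cong[OF refl]) (clarify, rule fibre)
  also have "\<dots> = card ?M * CARD('a) ^ n * card (S (Suc n))"
    by (simp add: card_cartesian_product card_PiE)
  \<comment> \<open>By Pascal's rule, \<open>Suc n choose 2\<close> is
    \<open>n + (n choose 2)\<close>.\<close>
  also have "\<dots> = (\<Prod>k=1..Suc n. card (S k)) * CARD('a) ^ (Suc n choose 2)"
    by (simp add: IH numeral_2_eq_2 power_add mult_ac)
  finally show ?case .
qed

section \<open>Squares in a finite field of odd order\<close>

lemma card_nonzero: "card (- {0 :: 'a::{zero,finite}}) = CARD('a) - 1"
  by (simp add: Compl_eq_Diff_UNIV card_Diff_singleton)

text \<open>Otherwise the characteristic would be 2, and it divides the order of the field.\<close>

lemma one_neq_minus_one_odd_card:
  assumes "odd CARD('a::{field,finite})"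
  shows "(1::'a) \<noteq> - 1"
proof
  assume "(1::'a) = - 1"
  then have "of_nat 2 = (0::'a)"
    by (simp add: eq_neg_iff_add_eq_0)
  then have "CHAR('a) dvd 2"
    by (simp only: of_nat_eq_0_iff_char_dvd)
  moreover have "CHAR('a) \<noteq> 1"
    by simp
  ultimately have "CHAR('a) = 2"
    by (metis prime_nat_iff two_is_prime_nat)
  then show False
    using CHAR_dvd_CARD[where 'a = 'a] assms by simp
qed

text \<open>Squaring maps the nonzero elements two-to-one onto the positive ones: the fibre over the
  square of \<open>z\<close> is \<open>{z, - z}\<close>.\<close>

lemma card_positive_elems:
  assumes "odd CARD('a::{field,finite})"
  shows "2 * card {x :: 'a. positive_elem x} = CARD('a) - 1"
proof -
  let ?P = "{x :: 'a. positive_elem x}"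
  have fibre: "card {x. x \<noteq> 0 \<and> x ^ 2 = y} = 2" if "y \<in> ?P" for y :: 'a
  proof -
    from that obtain z where z: "y = z ^ 2" "z \<noteq> 0"
      by (auto simp: positive_elem_def is_nth_power_def)
    have "z \<noteq> - z"
      using one_neq_minus_one_odd_card[OF assms] z(2)
      by (metis mult_cancel_right1 mult_minus_left)
    moreover have "{x. x \<noteq> 0 \<and> x ^ 2 = y} = {z, - z}"
      using z by (auto simp: power2_eq_iff)
    ultimately show ?thesis
      by simp
  qed
  have "- {0::'a} = (\<Union>y\<in>?P. {x. x \<noteq> 0 \<and> x ^ 2 = y})"
    by (auto simp: positive_elem_def is_nth_power_def)
  then have "card (- {0::'a}) = (\<Sum>y\<in>?P. card {x. x \<noteq> 0 \<and> x ^ 2 = y})"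
    by (simp only:) (rule card_UN_disjoint, auto)
  then show ?thesis
    using fibre by (simp add: card_nonzero)
qed

text \<open>The positive elements are half of the nonzero ones, so the negative elements, their
  complement there, are the other half.\<close>

lemma card_quadratic_character:
  assumes odd: "odd CARD('a::{field,finite})" and e: "e \<in> {1, -1}"
  shows "2 * card {x :: 'a. quadratic_character x = e} = CARD('a) - 1"
proof -
  let ?P = "{x :: 'a. positive_elem x}"
  have pos: "{x :: 'a. quadratic_character x = 1} = ?P"
    by (auto simp: quadratic_character_def positive_elem_def split: if_splits)
  have neg: "{x :: 'a. quadratic_character x = -1} = - {0} - ?P"
    by (auto simp: quadratic_character_def positive_elem_def split: if_splits)
  have "card (- {0} - ?P) = card (- {0::'a}) - card ?P"
    by (rule card_Diff_subset) (auto simp: positive_elem_def)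
  then show ?thesis
    using e card_positive_elems[OF odd] pos neg by (auto simp: card_nonzero)
qed

section \<open>The four cardinalities\<close>

lemma LPM_eq: "LPM n = minors_in n (\<lambda>_. - {0})"
  by (simp add: LPM_def minors_in_def)

lemma card_TPM: "card (TPM n :: 'a::{field,finite} mat set) = card (LPM n :: 'a mat set)"
  unfolding TPM_def LPM_eq card_trailing_minors_in[symmetric] by simp

lemma card_LPM:
  "card (LPM n :: 'a::{field,finite} mat set) = (CARD('a) - 1) ^ n * CARD('a) ^ (n choose 2)"
  unfolding LPM_eq by (subst card_minors_in) (simp_all add: card_nonzero)

lemma card_TPM_sign:
  "card (TPM_sign n \<epsilon> :: 'a::{field,finite} mat set) = card (LPM_sign n \<epsilon> :: 'a mat set)"
  using card_trailing_minors_in[of n "\<lambda>k. {x :: 'a. quadratic_character x = \<epsilon> k}"]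
  by (simp add: TPM_sign_def LPM_sign_def minors_in_def card_TPM)

lemma card_LPM_sign:
  assumes odd: "odd CARD('a::{field,finite})" and \<epsilon>: "\<And>k. k \<in> {1..n} \<Longrightarrow> \<epsilon> k \<in> {1, -1}"
  shows "2 ^ n * card (LPM_sign n \<epsilon> :: 'a mat set)
    = (CARD('a) - 1) ^ n * CARD('a) ^ (n choose 2)"
proof -
  let ?S = "\<lambda>k. {x :: 'a. quadratic_character x = \<epsilon> k}"
  \<comment> \<open>The character of 0 is 0, which is not an admissible sign.\<close>
  have "0 \<notin> ?S k" if "k \<in> {1..n}" for k
    using \<epsilon>[OF that] by (auto simp: quadratic_character_def)
  then have "card (minors_in n ?S) = (\<Prod>k=1..n. card (?S k)) * CARD('a) ^ (n choose 2)"
    by (rule card_minors_in)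
  \<comment> \<open>One factor 2 goes to each \<open>k\<close>, where it turns half of the nonzero
    elements into all of them.\<close>
  moreover have "2 ^ n * (\<Prod>k=1..n. card (?S k)) = (\<Prod>k=1..n. 2 * card (?S k))"
    by (simp add: prod.distrib)
  moreover have "\<dots> = (CARD('a) - 1) ^ n"
    using card_quadratic_character[OF odd \<epsilon>] by simp
  ultimately show ?thesis
    using odd by (simp add: LPM_sign_def minors_in_def mult.assoc[symmetric])
qed

theorem corollary1p5:
  fixes n q :: nat
  assumes "n \<ge> 1"
    and "q = CARD('a::{field,finite})"
  shows "(odd q \<longrightarrow> (\<forall>\<epsilon> :: nat \<Rightarrow> int. (\<forall>k\<in>{1..n}. \<epsilon> k \<in> {1, -1}) \<longrightarrow>
            card (TPM n :: 'a mat set) = card (LPM n :: 'a mat set) \<and>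
            card (LPM n :: 'a mat set) = 2 ^ n * card (LPM_sign n \<epsilon> :: 'a mat set) \<and>
            2 ^ n * card (LPM_sign n \<epsilon> :: 'a mat set) = 2 ^ n * card (TPM_sign n \<epsilon> :: 'a mat set) \<and>
            2 ^ n * card (TPM_sign n \<epsilon> :: 'a mat set) = (q - 1) ^ n * q ^ (n choose 2))) \<and>
         (even q \<longrightarrow> (\<forall>\<epsilon> :: nat \<Rightarrow> int. (\<forall>k\<in>{1..n}. \<epsilon> k \<in> {1, -1}) \<longrightarrow>
            card (TPM n :: 'a mat set) = card (LPM n :: 'a mat set) \<and>
            card (LPM n :: 'a mat set) = card (LPM_sign n \<epsilon> :: 'a mat set) \<and>
            card (LPM_sign n \<epsilon> :: 'a mat set) = card (TPM_sign n \<epsilon> :: 'a mat set) \<and>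
            card (TPM_sign n \<epsilon> :: 'a mat set) = (q - 1) ^ n * q ^ (n choose 2)))"
proof -
  have "card (TPM n :: 'a mat set) = card (LPM n :: 'a mat set)"
    "card (LPM n :: 'a mat set) = (q - 1) ^ n * q ^ (n choose 2)"
    using assms(2) by (simp_all add: card_TPM card_LPM)
  moreover have "card (TPM_sign n \<epsilon> :: 'a mat set) = card (LPM_sign n \<epsilon> :: 'a mat set)" for \<epsilon>
    by (rule card_TPM_sign)
  moreover have "2 ^ n * card (LPM_sign n \<epsilon> :: 'a mat set) = (q - 1) ^ n * q ^ (n choose 2)"
    if "odd q" "\<forall>k\<in>{1..n}. \<epsilon> k \<in> {1, -1}" for \<epsilon>
    unfolding assms(2) by (rule card_LPM_sign) (use that assms(2) in auto)
  \<comment> \<open>For even \<open>q\<close> this is the convention that signs are ignored, so the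
    unsigned count applies.\<close>
  moreover have "(LPM_sign n \<epsilon> :: 'a mat set) = LPM n" if "even q" for \<epsilon>
    using that assms(2) by (simp add: LPM_sign_def)
  ultimately show ?thesis
    by simp
qed

end
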